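(* Let $a<b$, let $f\in C^\infty[a,b]$ and let $g\in C^\infty[a,b]$ be real-valued. Let $n\ge1$ be an integer and suppose that $g$ has a single stationary point $\xi\in[a,b]$ of order $n$, in the sense that $$g'(\xi)=\dots=g^{(n)}(\xi)=0,\qquad g^{(n+1)}(\xi)>0,\qquad g'(x)\ne0\ \text{ for } x\in[a,b]\setminus\{\xi\}.$$ Put $\alpha=1/(n+1)$. Then for each integer $p\ge0$ there exists $C_p>0$ such that $$\left|F^{(p)}(\tau)\right|\ \le\ C_p\,|\tau-g(\xi)|^{\alpha-p-1},\qquad \tau\in[g(a),g(\xi))\cup(g(\xi),g(b)].$$
   Context: $g$ is strictly monotone on each of $[a,\xi)$ and $(\xi,b]$ (one of these is empty if $\xi$ is an endpoint). The function $F$ arises from the change of variables $\tau=g(x)$ applied separately on each piece: $F=(f\circ g^{-1})\,|(g^{-1})'|=(f\circ g^{-1})\,|g'\circ g^{-1}|^{-1}$, where $g^{-1}$ is the inverse of the restriction of $g$ to the corresponding piece. Here $[g(a),g(\xi))$ denotes the image of $[a,\xi)$ under $g$ and $(g(\xi),g(b)]$ denotes the image of $(\xi,b]$ under $g$ (so the endpoints may be in either order), and the estimate is asserted for each of the two corresponding branches of $F$. A piece is void if $\xi=a$ or $\xi=b$. *)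

theory Defs
  imports "HOL-Analysis.Analysis"
begin

text \<open>
  Iterated derivatives taken within a set \<open>S\<close>: one-sided at the endpoints that belong to an
  interval \<open>S\<close>, two-sided in its interior. On \<open>S\<close> the values depend only on the restriction of
  the function to \<open>S\<close>.
\<close>

primrec nderiv :: "nat \<Rightarrow> (real \<Rightarrow> 'a::real_normed_vector) \<Rightarrow> real set \<Rightarrow> real \<Rightarrow> 'a" where
  "nderiv 0 f S = f"
| "nderiv (Suc k) f S = (\<lambda>x. vector_derivative (nderiv k f S) (at x within S))"

definition smooth_on :: "(real \<Rightarrow> 'a::real_normed_vector) \<Rightarrow> real set \<Rightarrow> bool" where
  "smooth_on f S \<longleftrightarrow> (\<forall>k. \<forall>x\<in>S. nderiv k f S differentiable (at x within S))"

text \<open>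
  The branch \<open>(f \<circ> g\<inverse>) |(g\<inverse>)'|\<close> on \<open>g ` J\<close>, where \<open>g\<inverse>\<close> is the inverse of the restriction of
  \<open>g\<close> to \<open>J\<close>. The second form \<open>(f \<circ> g\<inverse>) |g' \<circ> g\<inverse>|\<inverse>\<close> is the lemma below.
\<close>

definition branch :: "(real \<Rightarrow> complex) \<Rightarrow> (real \<Rightarrow> real) \<Rightarrow> real set \<Rightarrow> real \<Rightarrow> complex" where
  "branch f g J \<tau> =
     f (inv_into J g \<tau>) * of_real \<bar>vector_derivative (inv_into J g) (at \<tau> within g ` J)\<bar>"

lemma branch_eq:
  assumes J: "is_interval J" "u \<in> J" "v \<in> J" "u \<noteq> v"
    and inj: "inj_on g J"
    and der: "\<And>x. x \<in> J \<Longrightarrow> (g has_vector_derivative g' x) (at x within J)"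
    and nz: "\<And>x. x \<in> J \<Longrightarrow> g' x \<noteq> 0"
    and \<tau>: "\<tau> \<in> g ` J"
  shows "branch f g J \<tau> = f (inv_into J g \<tau>) * of_real (inverse \<bar>g' (inv_into J g \<tau>)\<bar>)"
proof -
  let ?h = "inv_into J g"
  have cont: "continuous_on J g"
    using der by (meson continuous_on_eq_continuous_within has_vector_derivative_continuous)
  have "path_connected J"
    using J(1) by (simp add: is_interval_path_connected)
  then obtain h where h: "homeomorphism J (g ` J) g h"
    using homeomorphism_into_1d cont inj by blast
  have heq: "?h y = h y" if "y \<in> g ` J" for y
    using that h inj by (metis homeomorphism_def imageE inv_into_f_f)
  have conth: "continuous_on (g ` J) ?h"
    using h heq by (metis (no_types, lifting) continuous_on_cong homeomorphism_def)
  define x where "x = ?h \<tau>"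
  have x: "x \<in> J" "g x = \<tau>"
    using \<tau> by (auto simp: x_def inv_into_into f_inv_into_f)
  have "(?h has_derivative (\<lambda>t. t / g' x)) (at (g x) within g ` J)"
  proof (rule has_derivative_inverse_within)
    show "(g has_derivative (\<lambda>t. t * g' x)) (at x within J)"
      using der[OF x(1)] by (simp add: has_vector_derivative_def)
    show "continuous (at (g x) within g ` J) ?h"
      using conth x by (metis continuous_on_eq_continuous_within imageI)
    show "linear (\<lambda>t. t / g' x)"
      by (intro linearI) (auto simp: add_divide_distrib)
    show "(\<lambda>t. t / g' x) \<circ> (\<lambda>t. t * g' x) = id"
      using nz[OF x(1)] by auto
    show "?h (g y) = y" if "y \<in> J" for y
      using that inj by simp
  qed (use x in auto)
  then have hd: "(?h has_vector_derivative inverse (g' x)) (at \<tau> within g ` J)"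
    using x by (simp add: has_vector_derivative_def divide_inverse)
  have "connected (g ` J)"
    using J(1) cont by (simp add: connected_continuous_image is_interval_connected)
  moreover have "\<nexists>c. g ` J = {c}"
    using J inj by (metis image_eqI inj_onD singletonD)
  ultimately have "\<tau> islimpt g ` J"
    using \<tau> connected_imp_perfect by blast
  then have "vector_derivative ?h (at \<tau> within g ` J) = inverse (g' x)"
    using hd by (intro vector_derivative_within) (auto simp: trivial_limit_within)
  then show ?thesis
    by (simp add: branch_def x_def)
qed

end

theory Submission
  imports Defs
begin

text \<open>
  Write \<open>d = \<bar>x - \<xi>\<bar>\<close> and pull everything back to the variable \<open>x\<close>. If \<open>F (g x) = \<Phi> x\<close> on a
  monotone piece \<open>J\<close>, then the chain rule gives \<open>F' (g x) = \<Phi>' x / g' x\<close>. Hence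
  \<open>F\<^sup>(\<^sup>p\<^sup>) (g x) = \<Phi>\<^sub>p x\<close>, where \<open>\<Phi>\<^sub>0 = f / \<bar>g'\<bar>\<close> and \<open>\<Phi>\<^sub>p\<^sub>+\<^sub>1 = \<Phi>\<^sub>p' / g'\<close>, and no derivative of the inverse
  function beyond the first has to be estimated.

  The growth of \<open>\<Phi>\<^sub>p\<close> at \<open>\<xi>\<close> is bookkeeping in symbol classes. A function belongs to \<open>S\<^sup>m\<close> if its
  \<open>k\<close>-th derivative is \<open>O(d\<^sup>m\<^sup>-\<^sup>k)\<close> on \<open>J\<close> for every \<open>k\<close>. Differentiation maps \<open>S\<^sup>m\<close> to \<open>S\<^sup>m\<^sup>-\<^sup>1\<close>,
  products map \<open>S\<^sup>l \<times> S\<^sup>m\<close> to \<open>S\<^sup>l\<^sup>+\<^sup>m\<close> (\<open>symbol_scaleR\<close>), and the reciprocal of an element of \<open>S\<^sup>m\<close> that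
  is at least \<open>c d\<^sup>m\<close> in modulus lies in \<open>S\<^sup>-\<^sup>m\<close> (\<open>symbol_inverse\<close>). Taylor's formula at the stationary
  point puts \<open>g'\<close> in \<open>S\<^sup>n\<close> (\<open>g_nderiv_symbol\<close>) and bounds it below by \<open>c d\<^sup>n\<close> (\<open>slope_ge\<close>), so \<open>1 / g'\<close>
  is in \<open>S\<^sup>-\<^sup>n\<close>, while \<open>f\<close> is in \<open>S\<^sup>0\<close>. Each step from \<open>\<Phi>\<^sub>p\<close> to \<open>\<Phi>\<^sub>p\<^sub>+\<^sub>1\<close> costs one derivative and one
  factor \<open>1 / g'\<close>, hence \<open>n + 1\<close> powers of \<open>d\<close>. So \<open>\<Phi>\<^sub>p = O(d powr e)\<close> with
  \<open>e = - n - p (n + 1) = (n + 1) (\<alpha> - p - 1)\<close> (\<open>nderiv_branch_symbol\<close>).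

  Finally \<open>\<bar>g x - g \<xi>\<bar> \<le> B d\<^sup>n\<^sup>+\<^sup>1\<close> by Taylor's formula again, and because the exponent
  \<open>\<alpha> - p - 1\<close> is negative this upper bound for the increment of \<open>g\<close> turns the power of \<open>d\<close> into the
  asserted power of \<open>\<bar>\<tau> - g \<xi>\<bar>\<close> (\<open>nderiv_branch_bound\<close>).
\<close>

section \<open>Taylor bounds for smooth functions\<close>

lemma nderiv_has_vector_derivative:
  assumes "smooth_on f S" "x \<in> S"
  shows "(nderiv k f S has_vector_derivative nderiv (Suc k) f S x) (at x within S)"
  using assms by (simp add: smooth_on_def vector_derivative_works)

lemma nderiv_bounded:
  assumes "smooth_on f {a..b}"
  obtains B where "B > 0" "\<And>x. x \<in> {a..b} \<Longrightarrow> norm (nderiv k f {a..b} x) \<le> B"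
proof -
  have "continuous_on {a..b} (nderiv k f {a..b})"
    using nderiv_has_vector_derivative[OF assms]
    by (meson continuous_on_eq_continuous_within has_vector_derivative_continuous)
  then have "bounded (nderiv k f {a..b} ` {a..b})"
    using compact_continuous_image compact_imp_bounded by blast
  then show ?thesis
    using that by (auto simp: bounded_pos)
qed

lemma nderiv_Taylor:
  fixes g :: "real \<Rightarrow> real"
  assumes "smooth_on g {a..b}" "\<xi> \<in> {a..b}"
  obtains B where "B > 0"
    "\<And>x. x \<in> {a..b} \<Longrightarrow>
      \<bar>nderiv j g {a..b} x - (\<Sum>i\<le>N. nderiv (j + i) g {a..b} \<xi> * (x - \<xi>) ^ i / fact i)\<bar>
        \<le> B * \<bar>x - \<xi>\<bar> ^ Suc N"
proof -
  obtain B where B: "B > 0" "\<And>x. x \<in> {a..b} \<Longrightarrow> norm (nderiv (j + Suc N) g {a..b} x) \<le> B"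
    using nderiv_bounded[OF assms(1)] by blast
  show ?thesis
  proof (rule that)
    show "B / fact N > 0" using B(1) by simp
    fix x assume x: "x \<in> {a..b}"
    have "norm (nderiv (j + 0) g {a..b} x
        - (\<Sum>i\<le>N. nderiv (j + i) g {a..b} \<xi> * (x - \<xi>) ^ i / fact i))
        \<le> B * norm (x - \<xi>) ^ Suc N / fact N"
    proof (rule field_Taylor[where S = "{a..b}" and f = "\<lambda>i. nderiv (j + i) g {a..b}"])
      show "(nderiv (j + i) g {a..b} has_field_derivative nderiv (j + Suc i) g {a..b} y)
          (at y within {a..b})" if "y \<in> {a..b}" for i y
        using nderiv_has_vector_derivative[OF assms(1) that]
        by (simp add: has_real_derivative_iff_has_vector_derivative)
    qed (use B x assms in auto)
    then show "\<bar>nderiv j g {a..b} x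
        - (\<Sum>i\<le>N. nderiv (j + i) g {a..b} \<xi> * (x - \<xi>) ^ i / fact i)\<bar>
        \<le> B / fact N * \<bar>x - \<xi>\<bar> ^ Suc N"
      by simp
  qed
qed

section \<open>Symbol classes\<close>

text \<open>
  The class \<open>S\<^sup>m\<close> on \<open>J\<close>, with weight \<open>\<bar>x - \<xi>\<bar>\<close>, truncated after \<open>k\<close> derivatives. The recursion asks
  only for some function that is a derivative on \<open>J\<close>, instead of referring to iterated derivatives, so
  that the product rule can be applied at each level without Leibniz' formula. The truncation
  makes induction on \<open>k\<close> available.
\<close>

primrec symbol ::
  "nat \<Rightarrow> real set \<Rightarrow> real \<Rightarrow> real \<Rightarrow> (real \<Rightarrow> 'a::real_normed_vector) \<Rightarrow> bool" where
  "symbol 0 J \<xi> m u \<longleftrightarrow> (\<exists>C. \<forall>x\<in>J. norm (u x) \<le> C * \<bar>x - \<xi>\<bar> powr m)"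
| "symbol (Suc k) J \<xi> m u \<longleftrightarrow> (\<exists>C. \<forall>x\<in>J. norm (u x) \<le> C * \<bar>x - \<xi>\<bar> powr m) \<and>
    (\<exists>u'. (\<forall>x\<in>J. (u has_vector_derivative u' x) (at x within J)) \<and> symbol k J \<xi> (m - 1) u')"

lemma symbol_bound:
  assumes "symbol k J \<xi> m u"
  obtains C where "C > 0" "\<And>x. x \<in> J \<Longrightarrow> norm (u x) \<le> C * \<bar>x - \<xi>\<bar> powr m"
proof -
  obtain C where C: "\<And>x. x \<in> J \<Longrightarrow> norm (u x) \<le> C * \<bar>x - \<xi>\<bar> powr m"
    using assms by (cases k) auto
  have "norm (u x) \<le> max C 1 * \<bar>x - \<xi>\<bar> powr m" if "x \<in> J" for x
    using C[OF that] by (rule order_trans) (simp add: mult_right_mono)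
  then show ?thesis
    using that[of "max C 1"] by simp
qed

lemma symbol_SucD:
  "symbol (Suc k) J \<xi> m u \<Longrightarrow> symbol k J \<xi> m u"
proof (induction k arbitrary: m u)
  case (Suc k)
  then show ?case by (metis symbol.simps(2))
qed auto

lemma symbol_add:
  assumes "symbol k J \<xi> m u" "symbol k J \<xi> m v"
  shows "symbol k J \<xi> m (\<lambda>x. u x + v x)"
  using assms
proof (induction k arbitrary: m u v)
  have bd: "\<exists>C. \<forall>x\<in>J. norm (u x + v x) \<le> C * \<bar>x - \<xi>\<bar> powr m"
    if uv: "symbol k J \<xi> m u" "symbol k J \<xi> m v" for k m and u v :: "real \<Rightarrow> 'a"
  proof -
    obtain C where C: "\<And>x. x \<in> J \<Longrightarrow> norm (u x) \<le> C * \<bar>x - \<xi>\<bar> powr m"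
      using symbol_bound[OF uv(1)] by blast
    obtain D where D: "\<And>x. x \<in> J \<Longrightarrow> norm (v x) \<le> D * \<bar>x - \<xi>\<bar> powr m"
      using symbol_bound[OF uv(2)] by blast
    have "norm (u x + v x) \<le> (C + D) * \<bar>x - \<xi>\<bar> powr m" if "x \<in> J" for x
      using norm_triangle_ineq[of "u x" "v x"] C[OF that] D[OF that]
      by (simp add: distrib_right)
    then show ?thesis by blast
  qed
  {
    case 0
    then show ?case using bd[of 0] by simp
  next
    case (Suc k)
    obtain u' where u': "\<And>x. x \<in> J \<Longrightarrow> (u has_vector_derivative u' x) (at x within J)"
        "symbol k J \<xi> (m - 1) u'"
      using Suc.prems(1) by auto
    obtain v' where v': "\<And>x. x \<in> J \<Longrightarrow> (v has_vector_derivative v' x) (at x within J)"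
        "symbol k J \<xi> (m - 1) v'"
      using Suc.prems(2) by auto
    have "symbol k J \<xi> (m - 1) (\<lambda>x. u' x + v' x)"
      by (rule Suc.IH) fact+
    moreover have "\<forall>x\<in>J. ((\<lambda>x. u x + v x) has_vector_derivative u' x + v' x) (at x within J)"
      using u'(1) v'(1) by (auto intro: has_vector_derivative_add)
    ultimately show ?case
      using bd[OF Suc.prems] by auto
  }
qed

lemma symbol_scaleR:
  fixes r :: "real \<Rightarrow> real"
  assumes "symbol k J \<xi> l r" "symbol k J \<xi> m u"
  shows "symbol k J \<xi> (l + m) (\<lambda>x. r x *\<^sub>R u x)"
  using assms
proof (induction k arbitrary: l m r u)
  have bd: "\<exists>C. \<forall>x\<in>J. norm (r x *\<^sub>R u x) \<le> C * \<bar>x - \<xi>\<bar> powr (l + m)"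
    if ru: "symbol k J \<xi> l r" "symbol k J \<xi> m u"
    for k l m and r :: "real \<Rightarrow> real" and u :: "real \<Rightarrow> 'a"
  proof -
    obtain C where C: "C > 0" "\<And>x. x \<in> J \<Longrightarrow> norm (r x) \<le> C * \<bar>x - \<xi>\<bar> powr l"
      using symbol_bound[OF ru(1)] by blast
    obtain D where D: "\<And>x. x \<in> J \<Longrightarrow> norm (u x) \<le> D * \<bar>x - \<xi>\<bar> powr m"
      using symbol_bound[OF ru(2)] by blast
    have "norm (r x *\<^sub>R u x) \<le> (C * D) * \<bar>x - \<xi>\<bar> powr (l + m)" if "x \<in> J" for x
    proof -
      have "norm (r x) * norm (u x) \<le> (C * \<bar>x - \<xi>\<bar> powr l) * (D * \<bar>x - \<xi>\<bar> powr m)"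
        using C D that by (intro mult_mono) auto
      then show ?thesis by (simp add: powr_add mult_ac)
    qed
    then show ?thesis by blast
  qed
  {
    case 0
    then show ?case using bd[of 0] by simp
  next
    case (Suc k)
    obtain r' where r': "\<And>x. x \<in> J \<Longrightarrow> (r has_vector_derivative r' x) (at x within J)"
        "symbol k J \<xi> (l - 1) r'"
      using Suc.prems(1) by auto
    obtain u' where u': "\<And>x. x \<in> J \<Longrightarrow> (u has_vector_derivative u' x) (at x within J)"
        "symbol k J \<xi> (m - 1) u'"
      using Suc.prems(2) by auto
    have "symbol k J \<xi> (l + (m - 1)) (\<lambda>x. r x *\<^sub>R u' x)"
      by (rule Suc.IH[OF symbol_SucD[OF Suc.prems(1)] u'(2)])
    moreover have "symbol k J \<xi> ((l - 1) + m) (\<lambda>x. r' x *\<^sub>R u x)"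
      by (rule Suc.IH[OF r'(2) symbol_SucD[OF Suc.prems(2)]])
    ultimately have "symbol k J \<xi> (l + m - 1) (\<lambda>x. r x *\<^sub>R u' x + r' x *\<^sub>R u x)"
      by (intro symbol_add) (simp_all add: algebra_simps)
    moreover have "\<forall>x\<in>J. ((\<lambda>x. r x *\<^sub>R u x) has_vector_derivative r x *\<^sub>R u' x + r' x *\<^sub>R u x)
        (at x within J)"
      using r'(1) u'(1)
      by (auto intro!: has_vector_derivative_scaleR
          simp: has_real_derivative_iff_has_vector_derivative)
    ultimately show ?case
      using bd[OF Suc.prems] by auto
  }
qed

lemma symbol_const_scaleR:
  assumes "symbol k J \<xi> m u"
  shows "symbol k J \<xi> m (\<lambda>x. s *\<^sub>R u x)"
  using assms
proof (induction k arbitrary: m u)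
  have bd: "\<exists>C. \<forall>x\<in>J. norm (s *\<^sub>R u x) \<le> C * \<bar>x - \<xi>\<bar> powr m"
    if u: "symbol k J \<xi> m u" for k m and u :: "real \<Rightarrow> 'a"
  proof -
    obtain C where C: "\<And>x. x \<in> J \<Longrightarrow> norm (u x) \<le> C * \<bar>x - \<xi>\<bar> powr m"
      using symbol_bound[OF u] by blast
    have "norm (s *\<^sub>R u x) \<le> (\<bar>s\<bar> * C) * \<bar>x - \<xi>\<bar> powr m" if "x \<in> J" for x
      using mult_left_mono[OF C[OF that], of "\<bar>s\<bar>"] by (simp add: mult.assoc)
    then show ?thesis by blast
  qed
  {
    case 0
    then show ?case using bd[of 0] by simp
  next
    case (Suc k)
    obtain u' where u': "\<And>x. x \<in> J \<Longrightarrow> (u has_vector_derivative u' x) (at x within J)"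
        "symbol k J \<xi> (m - 1) u'"
      using Suc.prems by auto
    have "\<forall>x\<in>J. ((\<lambda>x. s *\<^sub>R u x) has_vector_derivative s *\<^sub>R u' x) (at x within J)"
      using u'(1)
      by (auto intro: bounded_linear.has_vector_derivative[OF bounded_linear_scaleR_right])
    then show ?case
      using bd[OF Suc.prems] Suc.IH[OF u'(2)] by auto
  }
qed

text \<open>
  The identity \<open>(1 / v)' = - (1 / v) (1 / v) v'\<close> expresses the derivative by \<open>1 / v\<close> itself, so control
  of \<open>k\<close> derivatives of \<open>1 / v\<close> yields control of \<open>k + 1\<close>. The orders match:
  \<open>- m - m + (m - 1) = - m - 1\<close>.
\<close>

lemma symbol_inverse:
  fixes v v' :: "real \<Rightarrow> real"
  assumes deriv: "\<And>x. x \<in> J \<Longrightarrow> (v has_vector_derivative v' x) (at x within J)"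
    and v': "\<And>k. symbol k J \<xi> (m - 1) v'"
    and c: "c > 0" and lower: "\<And>x. x \<in> J \<Longrightarrow> c * \<bar>x - \<xi>\<bar> powr m \<le> \<bar>v x\<bar>"
    and nz: "\<And>x. x \<in> J \<Longrightarrow> v x \<noteq> 0" and "\<xi> \<notin> J"
  shows "symbol k J \<xi> (- m) (\<lambda>x. inverse (v x))"
proof -
  have bd: "\<exists>C. \<forall>x\<in>J. norm (inverse (v x)) \<le> C * \<bar>x - \<xi>\<bar> powr (- m)"
  proof (intro exI ballI)
    fix x assume x: "x \<in> J"
    then have "c * \<bar>x - \<xi>\<bar> powr m > 0" using c \<open>\<xi> \<notin> J\<close> by (cases "x = \<xi>") auto
    then have "inverse \<bar>v x\<bar> \<le> inverse (c * \<bar>x - \<xi>\<bar> powr m)"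
      using lower[OF x] by (intro le_imp_inverse_le)
    then show "norm (inverse (v x)) \<le> inverse c * \<bar>x - \<xi>\<bar> powr (- m)"
      by (simp add: powr_minus)
  qed
  show ?thesis
  proof (induction k)
    case 0
    then show ?case using bd by simp
  next
    case (Suc k)
    have "symbol k J \<xi> (- m + (- m + (m - 1)))
        (\<lambda>x. (- 1) *\<^sub>R (inverse (v x) *\<^sub>R (inverse (v x) *\<^sub>R v' x)))"
      by (intro symbol_const_scaleR symbol_scaleR Suc v')
    moreover have "- m + (- m + (m - 1)) = - m - 1" by simp
    ultimately have "symbol k J \<xi> (- m - 1)
        (\<lambda>x. (- 1) *\<^sub>R (inverse (v x) *\<^sub>R (inverse (v x) *\<^sub>R v' x)))"
      by (simp only:)
    moreover have "\<forall>x\<in>J. ((\<lambda>x. inverse (v x)) has_vector_derivative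
        (- 1) *\<^sub>R (inverse (v x) *\<^sub>R (inverse (v x) *\<^sub>R v' x))) (at x within J)"
    proof
      fix x assume x: "x \<in> J"
      have "((\<lambda>x. inverse (v x)) has_real_derivative - (inverse (v x) * v' x * inverse (v x)))
          (at x within J)"
        using deriv[OF x] nz[OF x]
        by (intro DERIV_inverse') (simp_all add: has_real_derivative_iff_has_vector_derivative)
      then show "((\<lambda>x. inverse (v x)) has_vector_derivative
          (- 1) *\<^sub>R (inverse (v x) *\<^sub>R (inverse (v x) *\<^sub>R v' x))) (at x within J)"
        by (simp add: has_real_derivative_iff_has_vector_derivative mult_ac)
    qed
    ultimately show ?case
      using bd by auto
  qed
qed

text \<open>
  For a smooth function the symbol property reduces to pointwise bounds on its iterated derivatives.
  The starting index \<open>i\<close> is there for the phase, whose value at \<open>\<xi>\<close> does not have to vanish: its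
  bounds hold from the first derivative on.
\<close>

lemma symbol_nderiv:
  assumes sm: "smooth_on u I" and J: "J \<subseteq> I"
    and bd: "\<And>j. i \<le> j \<Longrightarrow>
      \<exists>C. \<forall>x\<in>J. norm (nderiv j u I x) \<le> C * \<bar>x - \<xi>\<bar> powr (m - real j)"
    and "i \<le> j"
  shows "symbol k J \<xi> (m - real j) (nderiv j u I)"
  using \<open>i \<le> j\<close>
proof (induction k arbitrary: j)
  case 0
  then show ?case using bd by simp
next
  case (Suc k)
  have "\<forall>x\<in>J. (nderiv j u I has_vector_derivative nderiv (Suc j) u I x) (at x within J)"
    using nderiv_has_vector_derivative[OF sm] J
    by (meson has_vector_derivative_within_subset subsetD)
  moreover have "symbol k J \<xi> (m - real j - 1) (nderiv (Suc j) u I)"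
    using Suc.IH[of "Suc j"] Suc.prems by (simp add: algebra_simps)
  ultimately show ?case
    using bd[OF Suc.prems] by auto
qed

text \<open>
  On a bounded interval a nonpositive power of the distance to \<open>\<xi>\<close> is bounded below by a positive
  constant, so bounded functions are dominated by it.
\<close>

lemma smooth_nonpos_bound:
  assumes "smooth_on u {a..b}" "J \<subseteq> {a..b}" "\<xi> \<in> {a..b}" "\<xi> \<notin> J" "m \<le> 0"
  shows "\<exists>C. \<forall>x\<in>J. norm (nderiv j u {a..b} x) \<le> C * \<bar>x - \<xi>\<bar> powr m"
proof -
  obtain B where B: "B > 0" "\<And>x. x \<in> {a..b} \<Longrightarrow> norm (nderiv j u {a..b} x) \<le> B"
    using nderiv_bounded[OF assms(1)] by blast
  have "norm (nderiv j u {a..b} x) \<le> B * (b - a) powr (- m) * \<bar>x - \<xi>\<bar> powr m"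
    if x: "x \<in> J" for x
  proof -
    have d: "0 < \<bar>x - \<xi>\<bar>" "\<bar>x - \<xi>\<bar> \<le> b - a"
      using x assms(2-4) by (auto simp: abs_le_iff subset_iff)
    have "1 = (b - a) powr (- m) * (b - a) powr m"
      using d by (simp flip: powr_add)
    also have "\<dots> \<le> (b - a) powr (- m) * \<bar>x - \<xi>\<bar> powr m"
      using d \<open>m \<le> 0\<close> by (intro mult_left_mono powr_mono2') auto
    finally have "B * 1 \<le> B * ((b - a) powr (- m) * \<bar>x - \<xi>\<bar> powr m)"
      using B(1) by (intro mult_left_mono) auto
    then show ?thesis
      using B(2)[of x] x assms(2) by (force simp: mult.assoc)
  qed
  then show ?thesis by blast
qed

section \<open>Flatness of the phase at the stationary point\<close>

locale stationary_phase =
  fixes g :: "real \<Rightarrow> real" and a b \<xi> :: real and n :: nat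
  assumes smooth: "smooth_on g {a..b}"
    and xi: "\<xi> \<in> {a..b}"
    and flat: "\<And>k. 1 \<le> k \<Longrightarrow> k \<le> n \<Longrightarrow> nderiv k g {a..b} \<xi> = 0"
    and top_nz: "nderiv (Suc n) g {a..b} \<xi> \<noteq> 0"
    and slope_nz: "\<And>x. x \<in> {a..b} \<Longrightarrow> x \<noteq> \<xi> \<Longrightarrow> nderiv 1 g {a..b} x \<noteq> 0"
begin

abbreviation slope :: "real \<Rightarrow> real" where
  "slope \<equiv> nderiv 1 g {a..b}"

lemma g_deriv:
  "x \<in> {a..b} \<Longrightarrow> S \<subseteq> {a..b} \<Longrightarrow> (g has_vector_derivative slope x) (at x within S)"
  using nderiv_has_vector_derivative[OF smooth, of x 0]
  by (auto intro: has_vector_derivative_within_subset)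

lemma slope_continuous: "continuous_on {a..b} slope"
  using nderiv_has_vector_derivative[OF smooth]
  by (meson continuous_on_eq_continuous_within has_vector_derivative_continuous)

lemma increment_le:
  obtains B where "B > 0" "\<And>x. x \<in> {a..b} \<Longrightarrow> \<bar>g x - g \<xi>\<bar> \<le> B * \<bar>x - \<xi>\<bar> ^ Suc n"
proof -
  have "(\<Sum>i\<le>n. nderiv (0 + i) g {a..b} \<xi> * (x - \<xi>) ^ i / fact i) = g \<xi>" for x
  proof -
    have "(\<Sum>i\<le>n. nderiv (0 + i) g {a..b} \<xi> * (x - \<xi>) ^ i / fact i)
        = (\<Sum>i\<in>{0::nat}. nderiv (0 + i) g {a..b} \<xi> * (x - \<xi>) ^ i / fact i)"
      by (rule sum.mono_neutral_right) (auto simp: flat Suc_le_eq)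
    then show ?thesis by simp
  qed
  then show ?thesis
    using nderiv_Taylor[OF smooth xi, of 0 n] that by auto
qed

text \<open>
  Near \<open>\<xi>\<close> the leading Taylor term \<open>A d\<^sup>n\<close> of the slope dominates the remainder \<open>B d\<^sup>n\<^sup>+\<^sup>1\<close>. Away from
  \<open>\<xi>\<close> the slope is bounded below by compactness.
\<close>

lemma slope_ge:
  obtains c where "c > 0" "\<And>x. x \<in> {a..b} \<Longrightarrow> c * \<bar>x - \<xi>\<bar> ^ n \<le> \<bar>slope x\<bar>"
proof -
  define A where "A = \<bar>nderiv (Suc n) g {a..b} \<xi>\<bar> / fact n"
  have A: "A > 0" using top_nz by (simp add: A_def)
  obtain B where B: "B > 0" and taylor: "\<And>x. x \<in> {a..b} \<Longrightarrow>
      \<bar>slope x - (\<Sum>i\<le>n. nderiv (1 + i) g {a..b} \<xi> * (x - \<xi>) ^ i / fact i)\<bar>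
        \<le> B * \<bar>x - \<xi>\<bar> ^ Suc n"
    using nderiv_Taylor[OF smooth xi, of 1 n] by blast
  have main: "(\<Sum>i\<le>n. nderiv (1 + i) g {a..b} \<xi> * (x - \<xi>) ^ i / fact i)
      = nderiv (Suc n) g {a..b} \<xi> / fact n * (x - \<xi>) ^ n" for x
  proof -
    have "(\<Sum>i\<le>n. nderiv (1 + i) g {a..b} \<xi> * (x - \<xi>) ^ i / fact i)
        = (\<Sum>i\<in>{n}. nderiv (1 + i) g {a..b} \<xi> * (x - \<xi>) ^ i / fact i)"
      by (rule sum.mono_neutral_right) (auto simp: flat simp del: nderiv.simps)
    then show ?thesis by simp
  qed
  \<comment> \<open>Within this distance the remainder is at most half of the leading term.\<close>
  define \<delta> where "\<delta> = A / (2 * B)"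
  have near: "A / 2 * \<bar>x - \<xi>\<bar> ^ n \<le> \<bar>slope x\<bar>" if x: "x \<in> {a..b}" "\<bar>x - \<xi>\<bar> \<le> \<delta>" for x
  proof -
    have "\<bar>nderiv (Suc n) g {a..b} \<xi> / fact n * (x - \<xi>) ^ n\<bar> = A * \<bar>x - \<xi>\<bar> ^ n"
      by (simp add: A_def abs_mult power_abs del: nderiv.simps)
    then have "A * \<bar>x - \<xi>\<bar> ^ n - \<bar>slope x\<bar> \<le> B * \<bar>x - \<xi>\<bar> ^ Suc n"
      using taylor[OF x(1)] unfolding main by linarith
    also have "\<dots> = (B * \<bar>x - \<xi>\<bar>) * \<bar>x - \<xi>\<bar> ^ n" by simp
    also have "\<dots> \<le> (A / 2) * \<bar>x - \<xi>\<bar> ^ n"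
      using x(2) B by (intro mult_right_mono) (simp_all add: \<delta>_def field_simps)
    finally show ?thesis by (simp add: algebra_simps)
  qed
  define K where "K = {a..b} \<inter> {x. \<delta> \<le> \<bar>x - \<xi>\<bar>}"
  have "\<delta> > 0" using A B by (simp add: \<delta>_def)
  have "\<exists>c>0. \<forall>x\<in>K. c \<le> \<bar>slope x\<bar>"
  proof (cases "K = {}")
    case False
    have "compact K"
      unfolding K_def by (intro compact_Int_closed closed_Collect_le continuous_intros) auto
    moreover have "continuous_on K (\<lambda>x. \<bar>slope x\<bar>)"
      by (intro continuous_intros continuous_on_subset[OF slope_continuous]) (auto simp: K_def)
    ultimately obtain x0 where "x0 \<in> K" "\<And>x. x \<in> K \<Longrightarrow> \<bar>slope x0\<bar> \<le> \<bar>slope x\<bar>"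
      using continuous_attains_inf False by metis
    moreover have "x0 \<in> {a..b}" "x0 \<noteq> \<xi>"
      using \<open>x0 \<in> K\<close> \<open>\<delta> > 0\<close> by (auto simp: K_def)
    then have "\<bar>slope x0\<bar> > 0"
      using slope_nz[of x0] by linarith
    ultimately show ?thesis by blast
  qed (auto intro: exI[of _ 1])
  then obtain c where c: "c > 0" "\<And>x. x \<in> K \<Longrightarrow> c \<le> \<bar>slope x\<bar>" by blast
  \<comment> \<open>The summand 1 keeps \<open>L\<close> positive when the interval is a single point.\<close>
  define L where "L = (b - a + 1) ^ n"
  have L: "L > 0" "\<bar>x - \<xi>\<bar> ^ n \<le> L" if "x \<in> {a..b}" for x
    using that xi by (auto simp: L_def intro!: power_mono)
  show ?thesis
  proof (rule that[of "min (A / 2) (c / L)"])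
    show "min (A / 2) (c / L) > 0" using A c L xi by simp
    fix x assume x: "x \<in> {a..b}"
    show "min (A / 2) (c / L) * \<bar>x - \<xi>\<bar> ^ n \<le> \<bar>slope x\<bar>"
    proof (cases "\<bar>x - \<xi>\<bar> \<le> \<delta>")
      case True
      have "min (A / 2) (c / L) * \<bar>x - \<xi>\<bar> ^ n \<le> A / 2 * \<bar>x - \<xi>\<bar> ^ n"
        by (intro mult_right_mono min.cobounded1) simp
      with near[OF x True] show ?thesis by linarith
    next
      case False
      have "min (A / 2) (c / L) * \<bar>x - \<xi>\<bar> ^ n \<le> (c / L) * L"
        using c(1) L[OF x] by (intro mult_mono) auto
      also have "\<dots> = c" using L[OF x] by simp
      also have "c \<le> \<bar>slope x\<bar>" using c(2) x False by (auto simp: K_def)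
      finally show ?thesis .
    qed
  qed
qed

text \<open>
  The stationary point may be an endpoint of \<open>{u..v}\<close>. This covers the injectivity on a piece as well
  as the fact that \<open>g\<close> does not return to its stationary value.
\<close>

lemma g_neq:
  assumes "u \<in> {a..b}" "v \<in> {a..b}" "u < v" "\<xi> \<notin> {u<..<v}"
  shows "g u \<noteq> g v"
proof
  assume eq: "g u = g v"
  have "\<exists>x\<in>{u<..<v}. g v - g u = (v - u) *\<^sub>R slope x"
  proof (rule mvt_simple[OF assms(3)])
    fix x assume "u \<le> x" "x \<le> v"
    then show "(g has_derivative (\<lambda>t. t *\<^sub>R slope x)) (at x within {u..v})"
      using g_deriv[of x "{u..v}"] assms by (auto simp: has_vector_derivative_def)
  qed
  then show False
    using eq slope_nz assms by force
qed

end

section \<open>One branch of the transformed amplitude\<close>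

locale phase_branch = stationary_phase +
  fixes J :: "real set"
  assumes J_interval: "is_interval J" and J_sub: "J \<subseteq> {a..b}" and xi_notin: "\<xi> \<notin> J"
    and J_ne: "\<exists>u\<in>J. \<exists>v\<in>J. u \<noteq> v"
begin

lemma xi_outside: "u \<in> J \<Longrightarrow> v \<in> J \<Longrightarrow> \<xi> \<notin> {u<..<v}"
  using J_interval xi_notin unfolding is_interval_1 by (metis greaterThanLessThan_iff less_le)

lemma g_inj: "inj_on g J"
proof (rule linorder_inj_onI)
  show "g u \<noteq> g v" if "u < v" "u \<in> J" "v \<in> J" for u v
    using g_neq[of u v] that J_sub xi_outside by blast
qed auto

lemma slope_nz_J: "x \<in> J \<Longrightarrow> slope x \<noteq> 0"
  using slope_nz J_sub xi_notin by blast

lemma g_continuous: "continuous_on J g"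
  using g_deriv[OF _ J_sub] J_sub
  by (meson continuous_on_eq_continuous_within has_vector_derivative_continuous subsetD)

lemma image_islimpt:
  assumes "\<tau> \<in> g ` J"
  shows "\<tau> islimpt g ` J"
proof -
  have "connected (g ` J)"
    using J_interval g_continuous by (simp add: connected_continuous_image is_interval_connected)
  moreover have "\<nexists>c. g ` J = {c}"
    using J_ne g_inj by (metis image_eqI inj_onD singletonD)
  ultimately show ?thesis
    using assms connected_imp_perfect by blast
qed

lemma inv_deriv:
  assumes x: "x \<in> J"
  shows "(inv_into J g has_vector_derivative inverse (slope x)) (at (g x) within g ` J)"
proof -
  have "path_connected J"
    using J_interval by (simp add: is_interval_path_connected)
  then obtain h where h: "homeomorphism J (g ` J) g h"
    using homeomorphism_into_1d g_continuous g_inj by blast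
  have heq: "inv_into J g y = h y" if "y \<in> g ` J" for y
    using that h g_inj by (metis homeomorphism_def imageE inv_into_f_f)
  have cont: "continuous_on (g ` J) (inv_into J g)"
    using h heq by (metis (no_types, lifting) continuous_on_cong homeomorphism_def)
  have "(inv_into J g has_derivative (\<lambda>t. t / slope x)) (at (g x) within g ` J)"
  proof (rule has_derivative_inverse_within)
    show "(g has_derivative (\<lambda>t. t * slope x)) (at x within J)"
      using g_deriv[OF _ J_sub, of x] x J_sub by (auto simp: has_vector_derivative_def)
    show "continuous (at (g x) within g ` J) (inv_into J g)"
      using cont x by (metis continuous_on_eq_continuous_within imageI)
    show "linear (\<lambda>t. t / slope x)"
      by (intro linearI) (auto simp: add_divide_distrib)
    show "(\<lambda>t. t / slope x) \<circ> (\<lambda>t. t * slope x) = id"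
      using slope_nz_J[OF x] by auto
    show "inv_into J g (g y) = y" if "y \<in> J" for y
      using that g_inj by simp
  qed (use x in auto)
  then show ?thesis
    by (simp add: has_vector_derivative_def divide_inverse)
qed

text \<open>
  This is the step from \<open>\<Phi>\<^sub>p\<close> to \<open>\<Phi>\<^sub>p\<^sub>+\<^sub>1\<close>: in the variable \<open>x\<close>, differentiation with respect to
  \<open>\<tau> = g x\<close> becomes differentiation followed by division by the slope.
\<close>

lemma deriv_along_g:
  assumes eq: "\<And>x. x \<in> J \<Longrightarrow> F (g x) = \<Phi> x"
    and deriv: "\<And>x. x \<in> J \<Longrightarrow> (\<Phi> has_vector_derivative \<Phi>' x) (at x within J)"
    and x: "x \<in> J"
  shows "(F has_vector_derivative inverse (slope x) *\<^sub>R \<Phi>' x) (at (g x) within g ` J)"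
proof -
  let ?h = "inv_into J g"
  have "?h (g x) = x" "?h ` g ` J = J"
    using x g_inj by (auto simp: image_comp)
  then have "(\<Phi> \<circ> ?h has_vector_derivative inverse (slope x) *\<^sub>R \<Phi>' x) (at (g x) within g ` J)"
    using vector_diff_chain_within[OF inv_deriv[OF x], of \<Phi> "\<Phi>' x"] deriv[OF x] by simp
  then show ?thesis
    by (rule has_vector_derivative_transform[rotated 2]) (use x g_inj eq in auto)
qed

text \<open>
  For \<open>j \<le> n\<close> all derivatives of \<open>g\<close> of orders \<open>j\<close> to \<open>n\<close> vanish at \<open>\<xi>\<close>, so Taylor's formula leaves only
  the remainder. For \<open>j > n\<close> the exponent is nonpositive and boundedness suffices.
\<close>

lemma g_nderiv_symbol:
  assumes "j \<ge> 1"
  shows "symbol k J \<xi> (real n + 1 - real j) (nderiv j g {a..b})"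
proof -
  have "\<exists>C. \<forall>x\<in>J. norm (nderiv i g {a..b} x) \<le> C * \<bar>x - \<xi>\<bar> powr (real n + 1 - real i)"
    if i: "i \<ge> 1" for i
  proof (cases "i \<le> n")
    case True
    have "(\<Sum>l\<le>n - i. nderiv (i + l) g {a..b} \<xi> * (x - \<xi>) ^ l / fact l) = 0" for x
      using i True by (intro sum.neutral) (simp add: flat)
    then obtain B where
      "\<And>x. x \<in> {a..b} \<Longrightarrow> \<bar>nderiv i g {a..b} x\<bar> \<le> B * \<bar>x - \<xi>\<bar> ^ Suc (n - i)"
      using nderiv_Taylor[OF smooth xi, of i "n - i"] by (metis (no_types, lifting) diff_zero)
    moreover have "\<bar>x - \<xi>\<bar> ^ Suc (n - i) = \<bar>x - \<xi>\<bar> powr (real n + 1 - real i)"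
      if "x \<in> J" for x
    proof -
      have "real n + 1 - real i = real (Suc (n - i))" using True by (simp add: of_nat_diff)
      moreover have "0 < \<bar>x - \<xi>\<bar>" using that xi_notin by auto
      ultimately show ?thesis by (simp only: powr_realpow)
    qed
    ultimately show ?thesis using J_sub by (metis real_norm_def subsetD)
  next
    case False
    then show ?thesis
      by (intro smooth_nonpos_bound smooth J_sub xi xi_notin) auto
  qed
  then show ?thesis
    using symbol_nderiv[OF smooth J_sub] assms by blast
qed

lemma inverse_slope_symbol: "symbol k J \<xi> (- real n) (\<lambda>x. inverse (slope x))"
proof -
  obtain c where c: "c > 0" "\<And>x. x \<in> {a..b} \<Longrightarrow> c * \<bar>x - \<xi>\<bar> ^ n \<le> \<bar>slope x\<bar>"
    using slope_ge by blast
  show ?thesis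
  proof (rule symbol_inverse[OF _ _ c(1)])
    show "(slope has_vector_derivative nderiv 2 g {a..b} x) (at x within J)" if "x \<in> J" for x
      using nderiv_has_vector_derivative[OF smooth, of x 1] that J_sub
      by (metis Suc_1 has_vector_derivative_within_subset subsetD)
    show "symbol k J \<xi> (real n - 1) (nderiv 2 g {a..b})" for k
      using g_nderiv_symbol[of 2 k] by simp
    show "c * \<bar>x - \<xi>\<bar> powr real n \<le> \<bar>slope x\<bar>" if "x \<in> J" for x
      using c(2)[of x] that J_sub xi_notin by (subst powr_realpow) auto
  qed (use slope_nz_J xi_notin in auto)
qed

text \<open>
  By connectedness the slope has constant sign on \<open>J\<close>, so the absolute value in the amplitude is a
  constant factor and does not interfere with differentiation.
\<close>

lemma abs_slope_eq:
  obtains s :: real where "\<And>x. x \<in> J \<Longrightarrow> \<bar>slope x\<bar> = s * slope x" "\<bar>s\<bar> = 1"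
proof -
  have "connected (slope ` J)"
    using J_interval slope_continuous J_sub
    by (meson connected_continuous_image continuous_on_subset is_interval_connected)
  then have "False" if "u \<in> J" "v \<in> J" "slope u < 0" "slope v > 0" for u v
    using connectedD_interval[of "slope ` J" "slope u" "slope v" 0] that slope_nz_J by force
  then have "(\<forall>x\<in>J. slope x > 0) \<or> (\<forall>x\<in>J. slope x < 0)"
    using slope_nz_J by (meson linorder_neqE_linordered_idom)
  then show ?thesis
  proof
    assume "\<forall>x\<in>J. slope x > 0"
    then show thesis by (intro that[of 1]) (simp_all add: abs_of_pos del: nderiv.simps One_nat_def)
  next
    assume "\<forall>x\<in>J. slope x < 0"
    then show thesis by (intro that[of "- 1"]) (simp_all add: abs_of_neg del: nderiv.simps One_nat_def)
  qed
qed

lemma amplitude_eq: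
  assumes "x \<in> J"
  shows "branch f g J (g x) = inverse \<bar>slope x\<bar> *\<^sub>R f x"
proof -
  obtain u v where uv: "u \<in> J" "v \<in> J" "u \<noteq> v" using J_ne by blast
  have "branch f g J (g x)
      = f (inv_into J g (g x)) * of_real (inverse \<bar>slope (inv_into J g (g x))\<bar>)"
    using assms J_sub by (intro branch_eq[OF J_interval uv g_inj] g_deriv slope_nz_J) auto
  then show ?thesis
    using assms g_inj by (simp add: scaleR_conv_of_real mult.commute)
qed

text \<open>
  The number \<open>k\<close> of controlled derivatives is arbitrary in the induction hypothesis, because each step
  uses up one of them.
\<close>

lemma nderiv_branch_symbol:
  fixes f :: "real \<Rightarrow> complex"
  assumes f: "smooth_on f {a..b}"
  shows "\<exists>\<Phi>. symbol k J \<xi> (- real n - real p * (real n + 1)) \<Phi> \<and>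
    (\<forall>x\<in>J. nderiv p (branch f g J) (g ` J) (g x) = \<Phi> x)"
proof (induction p arbitrary: k)
  case 0
  obtain s :: real where s: "\<And>x. x \<in> J \<Longrightarrow> \<bar>slope x\<bar> = s * slope x" "\<bar>s\<bar> = 1"
    using abs_slope_eq by blast
  have "inverse s = s" using s(2) by (cases "s < 0") auto
  then have "branch f g J (g x) = s *\<^sub>R (inverse (slope x) *\<^sub>R f x)" if "x \<in> J" for x
    using amplitude_eq[OF that] s(1)[OF that] by simp
  moreover have "symbol k J \<xi> (0 - real 0) (nderiv 0 f {a..b})"
    by (rule symbol_nderiv[OF f J_sub smooth_nonpos_bound[OF f J_sub xi xi_notin]]) auto
  then have "symbol k J \<xi> (- real n + 0) (\<lambda>x. s *\<^sub>R (inverse (slope x) *\<^sub>R f x))"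
    by (intro symbol_const_scaleR symbol_scaleR inverse_slope_symbol) simp
  ultimately show ?case
    by (intro exI[of _ "\<lambda>x. s *\<^sub>R (inverse (slope x) *\<^sub>R f x)"]) simp
next
  case (Suc p)
  obtain \<Phi> where \<Phi>: "symbol (Suc k) J \<xi> (- real n - real p * (real n + 1)) \<Phi>"
    "\<And>x. x \<in> J \<Longrightarrow> nderiv p (branch f g J) (g ` J) (g x) = \<Phi> x"
    using Suc by blast
  obtain \<Phi>' where \<Phi>': "\<And>x. x \<in> J \<Longrightarrow> (\<Phi> has_vector_derivative \<Phi>' x) (at x within J)"
    "symbol k J \<xi> (- real n - real p * (real n + 1) - 1) \<Phi>'"
    using \<Phi>(1) by auto
  have eq: "nderiv (Suc p) (branch f g J) (g ` J) (g x) = inverse (slope x) *\<^sub>R \<Phi>' x"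
    if "x \<in> J" for x
    using deriv_along_g[OF \<Phi>(2) \<Phi>'(1) that] image_islimpt[of "g x"] that
    by (auto intro!: vector_derivative_within simp: trivial_limit_within)
  have "symbol k J \<xi> (- real n + (- real n - real p * (real n + 1) - 1))
      (\<lambda>x. inverse (slope x) *\<^sub>R \<Phi>' x)"
    by (intro symbol_scaleR inverse_slope_symbol \<Phi>')
  moreover have "- real n + (- real n - real p * (real n + 1) - 1)
      = - real n - real (Suc p) * (real n + 1)"
    by (simp add: algebra_simps)
  ultimately have "symbol k J \<xi> (- real n - real (Suc p) * (real n + 1))
      (\<lambda>x. inverse (slope x) *\<^sub>R \<Phi>' x)"
    by (simp only:)
  with eq show ?case by blast
qed

lemma branch_smooth:
  fixes f :: "real \<Rightarrow> complex"
  assumes f: "smooth_on f {a..b}"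
  shows "smooth_on (branch f g J) (g ` J)"
  unfolding smooth_on_def
proof (intro allI ballI)
  fix p \<tau> assume "\<tau> \<in> g ` J"
  then obtain x where x: "x \<in> J" "\<tau> = g x" by blast
  obtain \<Phi> where \<Phi>: "symbol (Suc 0) J \<xi> (- real n - real p * (real n + 1)) \<Phi>"
    "\<And>x. x \<in> J \<Longrightarrow> nderiv p (branch f g J) (g ` J) (g x) = \<Phi> x"
    using nderiv_branch_symbol[OF f] by blast
  then obtain \<Phi>' where "\<And>x. x \<in> J \<Longrightarrow> (\<Phi> has_vector_derivative \<Phi>' x) (at x within J)"
    by auto
  from deriv_along_g[OF \<Phi>(2) this x(1)]
  show "nderiv p (branch f g J) (g ` J) differentiable (at \<tau> within g ` J)"
    unfolding x(2) by (rule differentiableI_vector)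
qed

lemma g_neq_stationary_value:
  assumes "x \<in> J"
  shows "g x \<noteq> g \<xi>"
proof -
  have "x \<in> {a..b}" "x \<noteq> \<xi>" using assms J_sub xi_notin by auto
  then show ?thesis
    using g_neq[of x \<xi>] g_neq[of \<xi> x] xi by (cases "x < \<xi>") auto
qed

text \<open>
  With \<open>e = \<alpha> - p - 1 \<le> 0\<close> the symbol bound is \<open>d powr ((n + 1) e) = (d\<^sup>n\<^sup>+\<^sup>1) powr e\<close>. Since \<open>powr e\<close>
  is antitone, replacing \<open>d\<^sup>n\<^sup>+\<^sup>1\<close> by the smaller \<open>\<bar>g x - g \<xi>\<bar> / B\<close> gives an upper bound.
\<close>

lemma nderiv_branch_bound:
  fixes f :: "real \<Rightarrow> complex"
  assumes f: "smooth_on f {a..b}"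
  shows "\<exists>C>0. \<forall>\<tau>\<in>g ` J. norm (nderiv p (branch f g J) (g ` J) \<tau>)
    \<le> C * \<bar>\<tau> - g \<xi>\<bar> powr (1 / (real n + 1) - real p - 1)"
proof -
  define e where "e = 1 / (real n + 1) - real p - 1"
  have e: "(real n + 1) * e = - real n - real p * (real n + 1)"
    by (simp add: e_def field_simps)
  have "1 / (real n + 1) \<le> 1" by simp
  then have "e \<le> 0" unfolding e_def by linarith
  obtain \<Phi> where \<Phi>: "symbol 0 J \<xi> ((real n + 1) * e) \<Phi>"
    "\<And>x. x \<in> J \<Longrightarrow> nderiv p (branch f g J) (g ` J) (g x) = \<Phi> x"
    using nderiv_branch_symbol[OF f] unfolding e by blast
  obtain C where C: "C > 0" "\<And>x. x \<in> J \<Longrightarrow> norm (\<Phi> x) \<le> C * \<bar>x - \<xi>\<bar> powr ((real n + 1) * e)"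
    using symbol_bound[OF \<Phi>(1)] by blast
  obtain B where B: "B > 0" "\<And>x. x \<in> {a..b} \<Longrightarrow> \<bar>g x - g \<xi>\<bar> \<le> B * \<bar>x - \<xi>\<bar> ^ Suc n"
    using increment_le by blast
  have "norm (nderiv p (branch f g J) (g ` J) (g x)) \<le> (C * B powr (- e)) * \<bar>g x - g \<xi>\<bar> powr e"
    if x: "x \<in> J" for x
  proof -
    have d: "\<bar>x - \<xi>\<bar> > 0" using x xi_notin by auto
    have t: "\<bar>g x - g \<xi>\<bar> > 0" using g_neq_stationary_value[OF x] by simp
    have "\<bar>x - \<xi>\<bar> powr ((real n + 1) * e) = (\<bar>x - \<xi>\<bar> ^ Suc n) powr e"
      using d powr_realpow[of "\<bar>x - \<xi>\<bar>" "Suc n"] by (simp add: add.commute flip: powr_powr)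
    also have "\<dots> \<le> (\<bar>g x - g \<xi>\<bar> / B) powr e"
      using B(1) B(2)[of x] x J_sub t \<open>e \<le> 0\<close>
      by (intro powr_mono2') (auto simp: pos_divide_le_eq mult.commute)
    also have "\<dots> = B powr (- e) * \<bar>g x - g \<xi>\<bar> powr e"
      using B(1) t by (simp add: powr_divide powr_minus_divide)
    finally have "C * \<bar>x - \<xi>\<bar> powr ((real n + 1) * e) \<le> C * (B powr (- e) * \<bar>g x - g \<xi>\<bar> powr e)"
      using C(1) by (intro mult_left_mono) auto
    then show ?thesis
      using C(2)[OF x] \<Phi>(2)[OF x] by (simp add: mult.assoc)
  qed
  then show ?thesis
    using C(1) B(1) unfolding e_def by (intro exI[of _ "C * B powr (- e)"]) (auto simp: e_def)
qed

end

section \<open>The amplitude after the change of variables\<close>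

theorem theorem4p1:
  fixes f :: "real \<Rightarrow> complex" and g :: "real \<Rightarrow> real" and a b \<xi> \<alpha> :: real and n :: nat
  assumes "a < b"
    and "smooth_on f {a..b}"
    and "smooth_on g {a..b}"
    and "n \<ge> 1"
    and "\<xi> \<in> {a..b}"
    and "\<And>k. 1 \<le> k \<Longrightarrow> k \<le> n \<Longrightarrow> nderiv k g {a..b} \<xi> = 0"
    and "nderiv (n + 1) g {a..b} \<xi> > 0"
    and "\<And>x. x \<in> {a..b} - {\<xi>} \<Longrightarrow> nderiv 1 g {a..b} x \<noteq> 0"
    and "\<alpha> = 1 / (real n + 1)"
  shows "(\<forall>J\<in>{{a..<\<xi>}, {\<xi><..b}}. smooth_on (branch f g J) (g ` J)) \<and>
    (\<forall>p. \<exists>C>0. \<forall>J\<in>{{a..<\<xi>}, {\<xi><..b}}. \<forall>\<tau>\<in>g ` J.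
      norm (nderiv p (branch f g J) (g ` J) \<tau>) \<le> C * \<bar>\<tau> - g \<xi>\<bar> powr (\<alpha> - real p - 1))"
proof -
  interpret stationary_phase g a b \<xi> n
    using assms by unfold_locales (auto simp del: nderiv.simps)
  have branch_cases: "J = {} \<or> phase_branch g a b \<xi> n J" if "J \<in> {{a..<\<xi>}, {\<xi><..b}}" for J
  proof (cases "J = {}")
    case False
    have "is_interval J" "J \<subseteq> {a..b}" "\<xi> \<notin> J"
      using that \<open>\<xi> \<in> {a..b}\<close> by (auto simp: is_interval_1)
    moreover have "infinite J"
      using that False infinite_Ico[of a \<xi>] infinite_Ioc[of \<xi> b]
      by (metis atLeastLessThan_empty greaterThanAtMost_empty insertE linorder_not_less
          singletonD)
    then have "\<exists>u\<in>J. \<exists>v\<in>J. u \<noteq> v"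
      by (metis finite.simps insert_iff subsetI subset_singletonD)
    ultimately have "phase_branch g a b \<xi> n J"
      by (intro phase_branch.intro phase_branch_axioms.intro stationary_phase_axioms)
    then show ?thesis ..
  qed simp
  have smooth_branch: "smooth_on (branch f g J) (g ` J)"
    if J: "J \<in> {{a..<\<xi>}, {\<xi><..b}}" for J
    using branch_cases[OF J] phase_branch.branch_smooth[of g a b \<xi> n J f] assms(2)
    by (auto simp: smooth_on_def)
  have bound_branch: "\<exists>C>0. \<forall>\<tau>\<in>g ` J. norm (nderiv p (branch f g J) (g ` J) \<tau>)
      \<le> C * \<bar>\<tau> - g \<xi>\<bar> powr (\<alpha> - real p - 1)"
    if J: "J \<in> {{a..<\<xi>}, {\<xi><..b}}" for J p
    using branch_cases[OF J] phase_branch.nderiv_branch_bound[of g a b \<xi> n J f p] assms(2)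
    unfolding \<open>\<alpha> = 1 / (real n + 1)\<close> by (auto intro: exI[of _ 1])
  have "\<exists>C>0. \<forall>J\<in>{{a..<\<xi>}, {\<xi><..b}}. \<forall>\<tau>\<in>g ` J.
      norm (nderiv p (branch f g J) (g ` J) \<tau>) \<le> C * \<bar>\<tau> - g \<xi>\<bar> powr (\<alpha> - real p - 1)" for p
  proof -
    obtain C where C: "\<And>J. J \<in> {{a..<\<xi>}, {\<xi><..b}} \<Longrightarrow> C J > 0 \<and> (\<forall>\<tau>\<in>g ` J.
        norm (nderiv p (branch f g J) (g ` J) \<tau>) \<le> C J * \<bar>\<tau> - g \<xi>\<bar> powr (\<alpha> - real p - 1))"
      using bound_branch[of _ p] by metis
    define M where "M = max (C {a..<\<xi>}) (C {\<xi><..b})"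
    have "norm (nderiv p (branch f g J) (g ` J) \<tau>) \<le> M * \<bar>\<tau> - g \<xi>\<bar> powr (\<alpha> - real p - 1)"
      if J: "J \<in> {{a..<\<xi>}, {\<xi><..b}}" and \<tau>: "\<tau> \<in> g ` J" for J \<tau>
    proof -
      have "C J \<le> M" using J by (auto simp: M_def)
      then have "C J * \<bar>\<tau> - g \<xi>\<bar> powr (\<alpha> - real p - 1) \<le> M * \<bar>\<tau> - g \<xi>\<bar> powr (\<alpha> - real p - 1)"
        by (intro mult_right_mono) auto
      with C[OF J] \<tau> show ?thesis by (meson order_trans)
    qed
    moreover have "M > 0" using C[of "{a..<\<xi>}"] by (auto simp: M_def)
    ultimately show ?thesis by blast
  qed
  then show ?thesis
    using smooth_branch by blast
qed

end
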